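(* Let $(t_n)$ be a subprime Fibonacci sequence and let $t_j=a$, $t_{j+1}=b$ be consecutive terms forming a node, i.e., $a,b$ are positive, odd and coprime, and $t_{j-1}$ (if $j\ge1$) is even. Suppose $b=a+2^{k-2}d$ where $k$ is an integer and $d$ is an odd integer with $d>-a/2^{k-2}$. Then for $i=1,\dots,k$, $$t_{j+i-1}=a+2^{k-i}J_{i-1}d,$$ the terms $t_j,\dots,t_{j+k-2}$ (there are $k-1\ge 2$ of them) are odd, and $t_{j+k-1}=a+J_{k-1}d$ is even. In other words, the run generated by the node $(a,b)$ has length $k$ and consists of these terms.
   Context: A subprime Fibonacci sequence is a sequence $(t_n)_{n\ge0}$ of positive integers with $t_0,t_1$ arbitrary and, for $s=t_n+t_{n+1}$: $t_{n+2}=s$ if $s$ is prime, $t_{n+2}=s/p$ if $s$ is composite, $p$ the smallest prime factor of $s$. The run generated by a node $(a,b)=(t_j,t_{j+1})$ is the block of consecutive terms starting at $t_j$ consisting of odd terms followed by the first even term. The Jacobsthal numbers are defined by $J_0=0$, $J_1=1$, $J_n=J_{n-1}+2J_{n-2}$ for $n\ge2$ (so $J_n=(2^n-(-1)^n)/3$). *)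

theory Defs
  imports Complex_Main "HOL-Computational_Algebra.Computational_Algebra"
begin

text \<open>Only used for \<open>s \<ge> 2\<close>, where \<open>s\<close> is composite iff it is not prime.\<close>

definition subprime :: "nat \<Rightarrow> nat" where
  "subprime s = (if prime s then s else s div Min (prime_factors s))"

definition subprime_fibonacci :: "(nat \<Rightarrow> nat) \<Rightarrow> bool" where
  "subprime_fibonacci t \<longleftrightarrow>
     (\<forall>n. 0 < t n) \<and> (\<forall>n. t (n + 2) = subprime (t n + t (n + 1)))"

definition is_node :: "(nat \<Rightarrow> nat) \<Rightarrow> nat \<Rightarrow> bool" where
  "is_node t j \<longleftrightarrow>
     0 < t j \<and> 0 < t (j + 1) \<and> odd (t j) \<and> odd (t (j + 1)) \<and> coprime (t j) (t (j + 1)) \<and>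
     (j \<ge> 1 \<longrightarrow> even (t (j - 1)))"

text \<open>There is at most one such list; there is none if all terms from index \<open>j\<close> on are odd.\<close>

definition is_run :: "(nat \<Rightarrow> nat) \<Rightarrow> nat \<Rightarrow> nat list \<Rightarrow> bool" where
  "is_run t j xs \<longleftrightarrow>
     xs \<noteq> [] \<and> xs = map t [j..<j + length xs] \<and>
     (\<forall>x\<in>set (butlast xs). odd x) \<and> even (last xs)"

fun jacobsthal :: "nat \<Rightarrow> nat" where
  "jacobsthal 0 = 0"
| "jacobsthal (Suc 0) = 1"
| "jacobsthal (Suc (Suc n)) = jacobsthal (Suc n) + 2 * jacobsthal n"

end

theory Submission imports Defs begin

text \<open>By the recurrence of the Jacobsthal numbers, consecutive terms of the claimed form add up to
  twice the next one. Two consecutive terms are never equal, as twice a Jacobsthal number is even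
  while its successor is odd; hence the sum exceeds 2, is composite, and the subprime rule halves
  it. All corrections to \<open>a\<close> are even except the last one, which is odd.\<close>

text \<open>The bound excludes \<open>m = 1\<close>, where the sum 2 is prime and would be kept
  whole. Beyond that, 2 is the smallest prime factor.\<close>

lemma subprime_double:
  assumes "m \<ge> 2"
  shows "subprime (2 * m) = m"
proof -
  have "\<not> prime (2 * m)"
    using prime_product[of 2 m] assms by auto
  moreover have "Min (prime_factors (2 * m)) = 2"
  proof (rule Min_eqI)
    show "2 \<in> prime_factors (2 * m)"
      using assms by (auto simp: prime_factors_dvd)
    show "2 \<le> p" if "p \<in> prime_factors (2 * m)" for p
      using that by (auto intro: prime_ge_2_nat)
  qed simp
  ultimately show ?thesis
    by (simp add: subprime_def)
qed

lemma odd_jacobsthal_Suc: "odd (jacobsthal (Suc n))"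
  by (induction n) simp_all

text \<open>Each halving uses up one factor 2 of the initial gap \<open>2 ^ m * d\<close>. The bound
  on \<open>i\<close> is where these factors run out, so the subtraction in the exponent never
  truncates. In the application \<open>m\<close> is \<open>k - 2\<close>.\<close>

lemma subprime_fibonacci_halving_terms:
  fixes d :: int
  assumes t: "subprime_fibonacci t"
    and step: "int (t (j + 1)) = int (t j) + 2 ^ m * d"
    and d: "d \<noteq> 0"
    and i: "i \<le> Suc m"
  shows "int (t (j + i)) = int (t j) + 2 ^ (Suc m - i) * int (jacobsthal i) * d"
  using i
proof (induction i rule: jacobsthal.induct)
  case 1
  then show ?case by simp
next
  case 2
  then show ?case using step by simp
next
  case (3 i)
  \<comment> \<open>The gap scaled for the new term: in units of \<open>e\<close> the exponents at
    \<open>i\<close>, \<open>Suc i\<close> and \<open>Suc (Suc i)\<close> become the factors 4, 2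
    and 1.\<close>
  define e :: int where "e = 2 ^ (m - Suc i) * d"
  have pows: "Suc m - i = Suc (Suc (m - Suc i))" "m - i = Suc (m - Suc i)"
    using 3 by auto
  have t0: "int (t (j + i)) = int (t j) + 4 * int (jacobsthal i) * e"
    using 3 by (simp add: e_def pows)
  have t1: "int (t (j + Suc i)) = int (t j) + 2 * int (jacobsthal (Suc i)) * e"
    using 3 by (simp add: e_def pows)
  define s where "s = int (t j) + int (jacobsthal (Suc (Suc i))) * e"
  have sum: "int (t (j + i)) + int (t (j + Suc i)) = 2 * s"
    unfolding t0 t1 s_def by (simp add: algebra_simps)
  have pos: "0 < t n" for n
    using t by (auto simp: subprime_fibonacci_def)
  have ne: "t (j + i) \<noteq> t (j + Suc i)"
  proof
    assume "t (j + i) = t (j + Suc i)"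
    then have "2 * (2 * int (jacobsthal i) - int (jacobsthal (Suc i))) * e = 0"
      using t0 t1 by (simp add: algebra_simps)
    moreover have "e \<noteq> 0"
      using d by (simp add: e_def)
    ultimately have "2 * jacobsthal i = jacobsthal (Suc i)"
      by simp
    then show False
      using odd_jacobsthal_Suc[of i] by (metis dvd_triv_left)
  qed
  \<comment> \<open>Distinct positive integers add up to at least 3, which rules out
    \<open>s = 1\<close>.\<close>
  have s2: "s \<ge> 2"
    using sum ne pos[of "j + i"] pos[of "j + Suc i"] by linarith
  then have "t (j + i) + t (j + Suc i) = 2 * nat s"
    using sum by linarith
  moreover have "t (j + Suc (Suc i)) = subprime (t (j + i) + t (j + Suc i))"
    using t by (auto simp: subprime_fibonacci_def dest: spec[of _ "j + i"])
  ultimately have "int (t (j + Suc (Suc i))) = s"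
    using s2 by (simp add: subprime_double)
  then show ?case
    by (simp add: s_def e_def)
qed

text \<open>A run is determined by the offset of its first even term: were its last offset below
  \<open>m\<close>, its last term would be odd; were it above \<open>m\<close>, the even term at
  \<open>m\<close> would lie in the odd part.\<close>

lemma is_run_iff_map:
  assumes odds: "\<And>i. i < m \<Longrightarrow> odd (t (j + i))" and ev: "even (t (j + m))"
  shows "is_run t j xs \<longleftrightarrow> xs = map t [j..<j + Suc m]"
proof
  assume run: "is_run t j xs"
  define n where "n = length xs - 1"
  have len: "length xs = Suc n"
    using run by (cases xs) (auto simp: is_run_def n_def)
  have xs: "xs = map t [j..<j + n] @ [t (j + n)]"
    using run len by (simp add: is_run_def)
  have last: "even (t (j + n))" and front: "\<And>i. i < n \<Longrightarrow> odd (t (j + i))"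
    using run xs by (auto simp: is_run_def butlast_append)
  have "n = m"
    using last front[of m] odds[of n] ev by (meson linorder_neqE_nat)
  then show "xs = map t [j..<j + Suc m]"
    using xs by simp
next
  assume xs: "xs = map t [j..<j + Suc m]"
  have "odd (t n)" if "j \<le> n" "n < j + m" for n
    using odds[of "n - j"] that by simp
  then show "is_run t j xs"
    using ev xs by (auto simp: is_run_def butlast_append)
qed

text \<open>If \<open>e \<le> 0\<close>, clearing the denominator makes the odd \<open>d\<close> a
  multiple of the even \<open>c\<close>. This serves to bound \<open>k\<close>, which is an
  arbitrary integer at the outset.\<close>

lemma odd_powi_exponent_pos:
  fixes d e c :: int
  assumes "real_of_int c = 2 powi e * real_of_int d" "odd d" "even c"
  shows "e > 0"
proof (rule ccontr)
  assume "\<not> e > 0"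
  then have "real_of_int d = real_of_int c * 2 ^ nat (- e)"
    using assms(1) by (cases "e = 0") (auto simp: power_int_def field_simps)
  then have "d = c * 2 ^ nat (- e)"
    by (metis of_int_eq_iff of_int_mult of_int_numeral of_int_power)
  then show False
    using assms(2,3) by simp
qed

theorem theorem8:
  fixes t :: "nat \<Rightarrow> nat" and j a b :: nat and k d :: int
  assumes "subprime_fibonacci t"
    and "t j = a" and "t (j + 1) = b"
    and "is_node t j"
    and "real b = real a + 2 powi (k - 2) * real_of_int d"
    and "odd d"
    and "real_of_int d > - real a / 2 powi (k - 2)"
  shows "(\<forall>i::nat. 1 \<le> i \<and> int i \<le> k \<longrightarrow>
            real (t (j + i - 1)) =
              real a + 2 powi (k - int i) * real (jacobsthal (i - 1)) * real_of_int d)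
       \<and> k - 1 \<ge> 2
       \<and> (\<forall>n. j \<le> n \<and> int n \<le> int j + k - 2 \<longrightarrow> odd (t n))
       \<and> int (t (j + nat k - 1)) = int a + int (jacobsthal (nat k - 1)) * d
       \<and> even (t (j + nat k - 1))
       \<and> (\<forall>xs. is_run t j xs \<longleftrightarrow>
            int (length xs) = k \<and>
            (\<forall>i::nat. 1 \<le> i \<and> int i \<le> k \<longrightarrow>
               real (xs ! (i - 1)) =
                 real a + 2 powi (k - int i) * real (jacobsthal (i - 1)) * real_of_int d))"
proof -
  have "odd a" "odd b"
    using assms(2-4) by (auto simp: is_node_def)
  have diff: "real_of_int (int b - int a) = 2 powi (k - 2) * real_of_int d"
    using assms(5) by simp
  have "even (int b - int a)"
    using \<open>odd a\<close> \<open>odd b\<close> by simp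
  \<comment> \<open>Both node terms are odd, so their difference is even and \<open>k - 2\<close> is
    positive. From here on, powers with natural exponents suffice.\<close>
  from odd_powi_exponent_pos[OF diff assms(6) this] have k3: "k \<ge> 3"
    by simp
  define m where "m = nat (k - 2)"
  have k: "k = int m + 2" and m: "m \<ge> 1"
    using k3 by (auto simp: m_def)
  have "real_of_int (int b - int a) = real_of_int (2 ^ m * d)"
    using diff by (simp add: k)
  then have step: "int (t (j + 1)) = int (t j) + 2 ^ m * d"
    using assms(2,3) by linarith
  have terms: "int (t (j + i)) = int a + 2 ^ (Suc m - i) * int (jacobsthal i) * d"
    if "i \<le> Suc m" for i
    using subprime_fibonacci_halving_terms[OF assms(1) step _ that] assms(2,6) by auto
  have formula: "real (t (j + i - 1)) =
      real a + 2 powi (k - int i) * real (jacobsthal (i - 1)) * real_of_int d"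
    if "1 \<le> i" "int i \<le> k" for i
  proof -
    \<comment> \<open>The theorem counts terms from 1, \<open>terms\<close> counts offsets from 0;
      hence the shift to \<open>i - 1\<close>.\<close>
    have exps: "k - int i = int (Suc m - (i - 1))" "j + i - 1 = j + (i - 1)"
      and "i - 1 \<le> Suc m"
      using that k by auto
    then show ?thesis
      unfolding exps power_int_of_nat using arg_cong[OF terms[of "i - 1"], of real_of_int] by simp
  qed
  have odds: "odd (t (j + i))" if "i < Suc m" for i
  proof -
    have "odd (int (t (j + i)))"
      using terms[of i] that \<open>odd a\<close> by simp
    then show ?thesis by simp
  qed
  have last: "int (t (j + Suc m)) = int a + int (jacobsthal (Suc m)) * d"
    using terms[of "Suc m"] by simp
  have "even (int (t (j + Suc m)))"
    unfolding last using \<open>odd a\<close> assms(6) odd_jacobsthal_Suc[of m] by simp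
  then have ev: "even (t (j + Suc m))"
    by simp
  have nk: "nat k - 1 = Suc m" "j + nat k - 1 = j + Suc m"
    using k by auto
  have run: "is_run t j xs \<longleftrightarrow> int (length xs) = k \<and>
      (\<forall>i::nat. 1 \<le> i \<and> int i \<le> k \<longrightarrow> real (xs ! (i - 1)) =
        real a + 2 powi (k - int i) * real (jacobsthal (i - 1)) * real_of_int d)" for xs
  proof -
    \<comment> \<open>The offsets 0 to \<open>Suc m\<close> give \<open>m + 2 = k\<close> entries.
      List equality is split into length and entries, shifted to one-based indices, and carried over
      to the closed form by injectivity of the embedding into the reals.\<close>
    have "is_run t j xs \<longleftrightarrow> xs = map t [j..<j + Suc (Suc m)]"
      using odds ev by (rule is_run_iff_map)
    also have "\<dots> \<longleftrightarrow>
        length xs = Suc (Suc m) \<and> (\<forall>i<Suc (Suc m). xs ! i = t (j + i))"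
      by (auto simp: list_eq_iff_nth_eq simp del: upt_Suc)
    also have "(\<forall>i<Suc (Suc m). xs ! i = t (j + i)) \<longleftrightarrow>
        (\<forall>i::nat. 1 \<le> i \<and> int i \<le> k \<longrightarrow> xs ! (i - 1) = t (j + i - 1))"
      (is "?L \<longleftrightarrow> ?R")
    proof
      assume ?L
      show ?R
      proof (intro allI impI)
        fix i :: nat
        assume "1 \<le> i \<and> int i \<le> k"
        then show "xs ! (i - 1) = t (j + i - 1)"
          using \<open>?L\<close>[rule_format, of "i - 1"] k by auto
      qed
    next
      assume ?R
      show ?L
        using \<open>?R\<close>[rule_format, of "Suc _"] k by auto
    qed
    also have "\<dots> \<longleftrightarrow> (\<forall>i::nat. 1 \<le> i \<and> int i \<le> k \<longrightarrow> real (xs ! (i - 1)) =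
        real a + 2 powi (k - int i) * real (jacobsthal (i - 1)) * real_of_int d)"
      using formula by (metis of_nat_eq_iff)
    finally show ?thesis
      using k by auto
  qed
  have "odd (t n)" if "j \<le> n" "int n \<le> int j + k - 2" for n
    using odds[of "n - j"] that k by simp
  then show ?thesis
    using formula k3 last ev run unfolding nk by auto
qed

end
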